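(* Let $B$ be a Banach space, $D\subseteq B$ a nonempty closed convex subset, and $T:D\to D$ a weak-contraction map, i.e. there exist constants $\delta\in(0,1)$ and $L\ge 0$ such that $\|Tx-Ty\|\le \delta\|x-y\|+L\|y-Ty\|$ for all $x,y\in D$. Assume that the set $F_T$ of fixed points of $T$ is nonempty and let $u^\ast\in F_T$. Let $\{a_n^i\}_{n=0}^\infty$, $i\in\{0,1,2\}$, be real sequences in $[0,1]$ with $\sum_{k=0}^\infty a_k^1a_k^2=\infty$. Let $\{q_n\}_{n=0}^\infty$ be the SP iterative sequence of $T$ with parameters $\{a_n^0\},\{a_n^1\},\{a_n^2\}$ and initial point $q_0\in D$, and let $\{x_n\}_{n=0}^\infty$ be the Picard-S iterative sequence of $T$ with parameters $\{a_n^1\},\{a_n^2\}$ and initial point $x_0\in D$. Then the following are equivalent: (i) $\lim_{n\to\infty}\|x_n-u^\ast\|=0$; (ii) $\lim_{n\to\infty}\|q_n-u^\ast\|=0$.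
   Context: $\mathbb{N}$ denotes the set of nonnegative integers. $F_T=\{x\in D: Tx=x\}$. Picard-S iteration (initial point $x_0\in D$), for $n\in\mathbb{N}$: $$z_n=(1-a_n^2)x_n+a_n^2Tx_n,\qquad y_n=(1-a_n^1)Tx_n+a_n^1Tz_n,\qquad x_{n+1}=Ty_n.$$ SP iteration (initial point $q_0\in D$), for $n\in\mathbb{N}$: $$s_n=(1-a_n^2)q_n+a_n^2Tq_n,\qquad r_n=(1-a_n^1)s_n+a_n^1Ts_n,\qquad q_{n+1}=(1-a_n^0)r_n+a_n^0Tr_n.$$ *)

theory Defs
  imports "HOL-Analysis.Analysis"
begin

text \<open>A self-map of \<open>D\<close> is represented by a total function on the ambient space
  that sends \<open>D\<close> into \<open>D\<close>; its values outside \<open>D\<close> are irrelevant.\<close>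

definition weak_contraction_on :: "'a::real_normed_vector set \<Rightarrow> ('a \<Rightarrow> 'a) \<Rightarrow> bool" where
  "weak_contraction_on D T \<longleftrightarrow> T \<in> D \<rightarrow> D \<and>
     (\<exists>\<delta> L. 0 < \<delta> \<and> \<delta> < 1 \<and> 0 \<le> L \<and>
        (\<forall>x\<in>D. \<forall>y\<in>D. norm (T x - T y) \<le> \<delta> * norm (x - y) + L * norm (y - T y)))"

definition fixed_points_on :: "'a set \<Rightarrow> ('a \<Rightarrow> 'a) \<Rightarrow> 'a set" where
  "fixed_points_on D T = {x \<in> D. T x = x}"

primrec picard_S ::
  "('a::real_vector \<Rightarrow> 'a) \<Rightarrow> (nat \<Rightarrow> real) \<Rightarrow> (nat \<Rightarrow> real) \<Rightarrow> 'a \<Rightarrow> nat \<Rightarrow> 'a" where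
  "picard_S T a1 a2 x0 0 = x0"
| "picard_S T a1 a2 x0 (Suc n) =
    (let x = picard_S T a1 a2 x0 n;
         z = (1 - a2 n) *\<^sub>R x + a2 n *\<^sub>R T x;
         y = (1 - a1 n) *\<^sub>R T x + a1 n *\<^sub>R T z
     in T y)"

primrec SP_iteration ::
  "('a::real_vector \<Rightarrow> 'a) \<Rightarrow> (nat \<Rightarrow> real) \<Rightarrow> (nat \<Rightarrow> real) \<Rightarrow> (nat \<Rightarrow> real) \<Rightarrow> 'a \<Rightarrow> nat \<Rightarrow> 'a" where
  "SP_iteration T a0 a1 a2 q0 0 = q0"
| "SP_iteration T a0 a1 a2 q0 (Suc n) =
    (let q = SP_iteration T a0 a1 a2 q0 n;
         s = (1 - a2 n) *\<^sub>R q + a2 n *\<^sub>R T q;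
         r = (1 - a1 n) *\<^sub>R s + a1 n *\<^sub>R T s
     in (1 - a0 n) *\<^sub>R r + a0 n *\<^sub>R T r)"

end

theory Submission
  imports Defs
begin

text \<open>Taking \<open>y = u\<close> in the weak contraction condition removes the \<open>L\<close>-term, so
  \<open>\<parallel>T x - u\<parallel> \<le> \<delta> \<parallel>x - u\<parallel>\<close> on \<open>D\<close>. Hence both iterations converge to \<open>u\<close> unconditionally: the
  Picard-S errors decrease at least like \<open>\<delta>\<^sup>n\<close>, and the SP errors at least like
  \<open>exp (- (1 - \<delta>) (\<Sum>k<n. a1 k * a2 k))\<close>.\<close>

lemma weak_contraction_on_fixed_point:
  assumes "weak_contraction_on D T" and "u \<in> fixed_points_on D T"
  obtains \<delta> where "0 < \<delta>" and "\<delta> < 1"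
    and "\<And>x. x \<in> D \<Longrightarrow> norm (T x - u) \<le> \<delta> * norm (x - u)"
proof -
  obtain \<delta> L where "0 < \<delta>" "\<delta> < 1"
    and contr: "\<forall>x\<in>D. \<forall>y\<in>D. norm (T x - T y) \<le> \<delta> * norm (x - y) + L * norm (y - T y)"
    using assms(1) unfolding weak_contraction_on_def by blast
  moreover have "norm (T x - u) \<le> \<delta> * norm (x - u)" if "x \<in> D" for x
    using contr[rule_format, OF that, of u] assms(2) by (simp add: fixed_points_on_def)
  ultimately show ?thesis using that by blast
qed

lemma norm_convex_comb_diff_le:
  fixes x y u :: "'a::real_normed_vector"
  assumes "0 \<le> a" and "a \<le> 1"
  shows "norm ((1 - a) *\<^sub>R x + a *\<^sub>R y - u) \<le> (1 - a) * norm (x - u) + a * norm (y - u)"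
proof -
  have "(1 - a) *\<^sub>R x + a *\<^sub>R y - u = (1 - a) *\<^sub>R (x - u) + a *\<^sub>R (y - u)"
    by (simp add: algebra_simps)
  also have "norm \<dots> \<le> norm ((1 - a) *\<^sub>R (x - u)) + norm (a *\<^sub>R (y - u))"
    by (rule norm_triangle_ineq)
  finally show ?thesis using assms by simp
qed

lemma convex_comb_mem:
  assumes "convex D" and "x \<in> D" and "y \<in> D" and "0 \<le> a" and "a \<le> 1"
  shows "(1 - a) *\<^sub>R x + a *\<^sub>R y \<in> D"
  using assms by (intro convexD) auto

text \<open>Isolates what both convergence proofs use: a self-map of a convex set that pulls every
  point towards the one point \<open>u\<close>. Fixing \<open>\<delta>\<close> here makes all later
  estimates share the same rate.\<close>

locale quasi_contraction =
  fixes D :: "'a::real_normed_vector set" and T :: "'a \<Rightarrow> 'a" and u :: 'a and \<delta> :: real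
  assumes convex: "convex D" and self_map: "x \<in> D \<Longrightarrow> T x \<in> D"
    and pos: "0 < \<delta>" and less_1: "\<delta> < 1"
    and quasi_contr: "x \<in> D \<Longrightarrow> norm (T x - u) \<le> \<delta> * norm (x - u)"
begin

lemma mann_step_mem:
  assumes "x \<in> D" and "0 \<le> a" and "a \<le> 1"
  shows "(1 - a) *\<^sub>R x + a *\<^sub>R T x \<in> D"
  by (intro convex_comb_mem convex self_map assms)

text \<open>Convexity of the norm splits the error, and only the share \<open>a\<close> carried by
  \<open>T x\<close> shrinks by \<open>\<delta>\<close>, so the factor is (1 - a) + a *
  \<open>\<delta>\<close>. The SP rate comes from this factor.\<close>

lemma mann_step_le:
  assumes "x \<in> D" and "0 \<le> a" and "a \<le> 1"
  shows "norm ((1 - a) *\<^sub>R x + a *\<^sub>R T x - u) \<le> (1 - (1 - \<delta>) * a) * norm (x - u)"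
proof -
  have "norm ((1 - a) *\<^sub>R x + a *\<^sub>R T x - u) \<le> (1 - a) * norm (x - u) + a * norm (T x - u)"
    by (rule norm_convex_comb_diff_le[OF assms(2,3)])
  also have "\<dots> \<le> (1 - a) * norm (x - u) + a * (\<delta> * norm (x - u))"
    using mult_left_mono[OF quasi_contr[OF assms(1)] assms(2)] by simp
  also have "\<dots> = (1 - (1 - \<delta>) * a) * norm (x - u)" by (simp add: algebra_simps)
  finally show ?thesis .
qed

lemma mann_step_le_self:
  assumes "x \<in> D" and "0 \<le> a" and "a \<le> 1"
  shows "norm ((1 - a) *\<^sub>R x + a *\<^sub>R T x - u) \<le> norm (x - u)"
proof -
  have "(1 - (1 - \<delta>) * a) * norm (x - u) \<le> norm (x - u)"
    using assms(2) less_1 mult_right_mono[of "1 - (1 - \<delta>) * a" 1 "norm (x - u)"] by simp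
  then show ?thesis using mann_step_le[OF assms] by linarith
qed

lemma T_le_self:
  assumes "x \<in> D"
  shows "norm (T x - u) \<le> norm (x - u)"
  using quasi_contr[OF assms] mult_right_mono[of \<delta> 1 "norm (x - u)"] less_1 by simp

context
  fixes a1 a2 :: "nat \<Rightarrow> real"
  assumes a1: "\<And>n. a1 n \<in> {0..1}" and a2: "\<And>n. a2 n \<in> {0..1}"
begin

text \<open>The outer application of \<open>T\<close> alone supplies one factor
  \<open>\<delta>\<close> per step; the inner averages only have to not increase the error.
  Membership in \<open>D\<close> is carried through the induction because the contraction estimate
  is confined to \<open>D\<close>.\<close>

lemma picard_S_bound:
  assumes "x0 \<in> D"
  shows "picard_S T a1 a2 x0 n \<in> D \<and>
    norm (picard_S T a1 a2 x0 n - u) \<le> \<delta> ^ n * norm (x0 - u)"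
proof (induction n)
  case 0
  then show ?case using assms by simp
next
  case (Suc n)
  define x where "x = picard_S T a1 a2 x0 n"
  define z where "z = (1 - a2 n) *\<^sub>R x + a2 n *\<^sub>R T x"
  define y where "y = (1 - a1 n) *\<^sub>R T x + a1 n *\<^sub>R T z"
  have bounds: "0 \<le> a1 n" "a1 n \<le> 1" "0 \<le> a2 n" "a2 n \<le> 1" using a1[of n] a2[of n] by auto
  have step: "picard_S T a1 a2 x0 (Suc n) = T y"
    by (simp add: Let_def x_def y_def z_def)
  have x: "x \<in> D" "norm (x - u) \<le> \<delta> ^ n * norm (x0 - u)" using Suc.IH by (auto simp: x_def)
  have z: "z \<in> D" unfolding z_def using x(1) bounds(3,4) by (rule mann_step_mem)
  have y: "y \<in> D" unfolding y_def
    by (intro convex_comb_mem convex self_map x(1) z bounds)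
  have "norm (T z - u) \<le> norm (x - u)"
    using T_le_self[OF z] mann_step_le_self[OF x(1) bounds(3,4)] by (simp add: z_def)
  \<comment> \<open>Both points averaged in \<open>y\<close>, namely \<open>T x\<close> and
    \<open>T z\<close>, are at most as far from \<open>u\<close> as \<open>x\<close> is.\<close>
  then have "(1 - a1 n) * norm (T x - u) + a1 n * norm (T z - u)
      \<le> (1 - a1 n) * norm (x - u) + a1 n * norm (x - u)"
    by (intro add_mono mult_left_mono T_le_self x(1)) (use bounds in auto)
  then have "norm (y - u) \<le> norm (x - u)"
    using norm_convex_comb_diff_le[OF bounds(1,2), of "T x" "T z" u]
    by (simp add: y_def algebra_simps)
  with x(2) have "norm (y - u) \<le> \<delta> ^ n * norm (x0 - u)" by linarith
  then have "norm (T y - u) \<le> \<delta> * (\<delta> ^ n * norm (x0 - u))"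
    using quasi_contr[OF y] mult_left_mono[of "norm (y - u)" "\<delta> ^ n * norm (x0 - u)" \<delta>] pos
    by linarith
  then show ?case using self_map[OF y] unfolding step by (simp add: mult.assoc)
qed

lemma picard_S_tendsto:
  assumes "x0 \<in> D"
  shows "(\<lambda>n. norm (picard_S T a1 a2 x0 n - u)) \<longlonglongrightarrow> 0"
proof (rule Lim_null_comparison)
  show "(\<lambda>n. \<delta> ^ n * norm (x0 - u)) \<longlonglongrightarrow> 0"
    using pos less_1 by (intro tendsto_mult_left_zero LIMSEQ_realpow_zero) auto
qed (use picard_S_bound[OF assms] in auto)

text \<open>Of the three averaging steps only the middle one, with weight \<open>a1 n\<close>, is
  used for its gain; the other two are bounded by factor 1. Putting the gain in exponential form
  makes the product over the steps an exponential of a sum.\<close>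

lemma SP_iteration_bound:
  assumes "q0 \<in> D" and a0: "\<And>n. a0 n \<in> {0..1}"
  shows "SP_iteration T a0 a1 a2 q0 n \<in> D \<and>
    norm (SP_iteration T a0 a1 a2 q0 n - u)
      \<le> exp (- (1 - \<delta>) * (\<Sum>k<n. a1 k * a2 k)) * norm (q0 - u)"
proof (induction n)
  case 0
  then show ?case using assms by simp
next
  case (Suc n)
  define q where "q = SP_iteration T a0 a1 a2 q0 n"
  define s where "s = (1 - a2 n) *\<^sub>R q + a2 n *\<^sub>R T q"
  define r where "r = (1 - a1 n) *\<^sub>R s + a1 n *\<^sub>R T s"
  let ?E = "\<lambda>n. exp (- (1 - \<delta>) * (\<Sum>k<n. a1 k * a2 k))"
  let ?c = "exp (- (1 - \<delta>) * (a1 n * a2 n))"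
  have bounds: "0 \<le> a0 n" "a0 n \<le> 1" "0 \<le> a1 n" "a1 n \<le> 1" "0 \<le> a2 n" "a2 n \<le> 1"
    using a0[of n] a1[of n] a2[of n] by auto
  have step: "SP_iteration T a0 a1 a2 q0 (Suc n) = (1 - a0 n) *\<^sub>R r + a0 n *\<^sub>R T r"
    by (simp add: Let_def q_def r_def s_def)
  have q: "q \<in> D" "norm (q - u) \<le> ?E n * norm (q0 - u)" using Suc.IH by (auto simp: q_def)
  have s: "s \<in> D" unfolding s_def using q(1) bounds(5,6) by (rule mann_step_mem)
  have r: "r \<in> D" unfolding r_def using s bounds(3,4) by (rule mann_step_mem)
  \<comment> \<open>Since \<open>a2 n\<close> is at most 1, the gain is weakened to the product
    whose series is assumed to diverge.\<close>
  have "1 - (1 - \<delta>) * a1 n \<le> 1 - (1 - \<delta>) * (a1 n * a2 n)"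
    using mult_left_mono[OF mult_left_le[OF bounds(6,3)], of "1 - \<delta>"] less_1 by simp
  \<comment> \<open>This is 1 + t \<le> exp t at t = -(1 - \<open>\<delta>\<close>) *
    \<open>a1 n\<close> * \<open>a2 n\<close>.\<close>
  also have "\<dots> \<le> ?c"
    using exp_ge_add_one_self[of "- (1 - \<delta>) * (a1 n * a2 n)"] by (simp only: mult_minus_left)
  finally have factor: "1 - (1 - \<delta>) * a1 n \<le> ?c" .
  have "norm ((1 - a0 n) *\<^sub>R r + a0 n *\<^sub>R T r - u) \<le> norm (r - u)"
    using r bounds(1,2) by (rule mann_step_le_self)
  also have "\<dots> \<le> (1 - (1 - \<delta>) * a1 n) * norm (s - u)"
    unfolding r_def using s bounds(3,4) by (rule mann_step_le)
  also have "\<dots> \<le> ?c * norm (q - u)"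
    using factor mann_step_le_self[OF q(1) bounds(5,6)]
    by (intro mult_mono) (auto simp: s_def)
  also have "\<dots> \<le> ?c * (?E n * norm (q0 - u))"
    using q(2) by (rule mult_left_mono) simp
  also have "\<dots> = ?E (Suc n) * norm (q0 - u)"
    by (simp add: distrib_left exp_add)
  finally show ?case
    using mann_step_mem[OF r bounds(1,2)] unfolding step by simp
qed

lemma SP_iteration_tendsto:
  assumes "q0 \<in> D" and "\<And>n. a0 n \<in> {0..1}"
    and div: "filterlim (\<lambda>n. \<Sum>k<n. a1 k * a2 k) at_top sequentially"
  shows "(\<lambda>n. norm (SP_iteration T a0 a1 a2 q0 n - u)) \<longlonglongrightarrow> 0"
proof (rule Lim_null_comparison)
  \<comment> \<open>As \<open>\<delta>\<close> < 1, the divergent partial sums are multiplied by a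
    negative constant, so the exponential in the bound vanishes in the limit.\<close>
  have "filterlim (\<lambda>n. - (1 - \<delta>) * (\<Sum>k<n. a1 k * a2 k)) at_bot sequentially"
    using less_1 by (intro filterlim_tendsto_neg_mult_at_bot[OF tendsto_const _ div]) simp
  then show "(\<lambda>n. exp (- (1 - \<delta>) * (\<Sum>k<n. a1 k * a2 k)) * norm (q0 - u)) \<longlonglongrightarrow> 0"
    by (intro tendsto_mult_left_zero filterlim_compose[OF exp_at_bot])
qed (use SP_iteration_bound[of q0 a0] assms in auto)

end

end

theorem theorem2:
  fixes D :: "'a::banach set" and T :: "'a \<Rightarrow> 'a" and u x0 q0 :: 'a
    and a0 a1 a2 :: "nat \<Rightarrow> real"
  assumes "D \<noteq> {}" and "closed D" and "convex D"
    and "weak_contraction_on D T"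
    and "fixed_points_on D T \<noteq> {}" and "u \<in> fixed_points_on D T"
    and "\<And>n. a0 n \<in> {0..1}" and "\<And>n. a1 n \<in> {0..1}" and "\<And>n. a2 n \<in> {0..1}"
    and "filterlim (\<lambda>n. \<Sum>k<n. a1 k * a2 k) at_top sequentially"
    and "x0 \<in> D" and "q0 \<in> D"
  shows "((\<lambda>n. norm (picard_S T a1 a2 x0 n - u)) \<longlonglongrightarrow> 0) \<longleftrightarrow>
         ((\<lambda>n. norm (SP_iteration T a0 a1 a2 q0 n - u)) \<longlonglongrightarrow> 0)"
proof -
  obtain \<delta> where "0 < \<delta>" "\<delta> < 1"
    and "\<And>x. x \<in> D \<Longrightarrow> norm (T x - u) \<le> \<delta> * norm (x - u)"
    using weak_contraction_on_fixed_point assms(4,6) by blast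
  then interpret quasi_contraction D T u \<delta>
    using assms(3,4) by unfold_locales (auto simp: weak_contraction_on_def)
  \<comment> \<open>Each side of the equivalence holds outright, so neither limit is derived from
    the other.\<close>
  show ?thesis
    using picard_S_tendsto[OF assms(8,9,11)] SP_iteration_tendsto[OF assms(8,9,12,7,10)] by simp
qed

end
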